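(* Let $R_{(\mathbb{G},\mathcal{S})}(\mathbb{X},\mathcal{C})$ be a Ramsey number with a base and symbol of locally finite type. Let $f_i:A_i\to\mathbb{F}_{q_i}$ be injections ($q_i\ge|A_i|$ prime powers), $S_i'=\{f_i\circ\rho:\rho\in S_i\}$ and $C_i'=\{f_i\circ\psi_j\}_{j\in J_i}$. Then $R_{(\mathbb{G},\mathcal{S})}(\mathbb{X},\mathcal{C})=n$ if and only if $n$ is the least value in $I$ such that for all $t\ge n$, $$S_t'\subseteq V\big(\langle p[G_t,\mathbb{X}_t,C_t']\rangle\big),$$ or, equivalently, $I(S_t')\supseteq\langle p[G_t,\mathbb{X}_t,C_t']\rangle$ for all $t\ge n$.
   Context: All graphs are finite and undirected; $\mathrm{Hom}(G,A)$ is the set of maps $E(G)\to A$. The isomorphism set $G/X$ is the set of edge maps $\pi:E(Y)\to E(X)$ induced by graph isomorphisms $V(Y)\to V(X)$, $Y$ ranging over subgraphs of $G$; $\pi^{-1}(X)$ denotes $E(Y)$. $I$ is strictly well-ordered with least element $0$; $\mathbb{G}=\{G_i\}_{i\in I}$ is hereditary: for $0<i\le k$, each $G_s$ with $s<i$ satisfies $G_t/G_s\ne\emptyset$ for all $t\ge k$. Ramsey base $(\mathbb{G},\mathcal{S})$: $\mathcal{S}=\{S_i\}$, $S_i\subseteq\mathrm{Hom}(G_i,A_i)$. Ramsey symbol $(\mathbb{X},\mathcal{C})$: $\mathbb{X}=\{\mathbb{X}_i\}$, $\mathbb{X}_i=\{X_j\}_{j\in J_i}$ ($J_i$ finite), $C_i=\{\psi_j\}_{j\in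 J_i}$, $\psi_j\in\mathrm{Hom}(X_j,A_i)$, with $\{\coprod_{j\in J_i}X_j\}_i$ hereditary. Locally finite type: $|A_i|<\infty$ for all $i$. $R_{(\mathbb{G},\mathcal{S})}(\mathbb{X},\mathcal{C})$ is the least $n\in I$ (if any) such that for all $t\ge n$ and all $\rho\in S_t$ there exist $j\in J_t$, $\pi\in G_t/X_j$ with $\rho(e)=\psi_j(\pi(e))$ for all $e\in\pi^{-1}(X_j)$. Colorings are identified with points of $\mathbb{F}_q^{(E(G))}$. For $\phi\in\mathrm{Hom}(X,\mathbb{F}_q)$, $p[G,X,\phi](x)=\prod_{\pi\in G/X}\big(1-\prod_{e\in\pi^{-1}(X)}(1-(x_e-\phi(\pi(e)))^{q-1})\big)$, and $p[G,\{X_j\},\{\phi_j\}]=\prod_j p[G,X_j,\phi_j]$. $V(\mathcal{J})$ is the common zero set in $\mathbb{F}_{q_t}^{(E(G_t))}$ of an ideal $\mathcal{J}$; $I(U)$ is the ideal of polynomials vanishing on a point set $U$. *)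

theory Defs
  imports "HOL-Algebra.Algebra" "HOL-Library.FuncSet" "HOL-Number_Theory.Prime_Powers"
begin

record 'v ugraph =
  verts :: "'v set"
  edges :: "'v set set"

text \<open>Finite undirected graphs, an edge being the set of its end points. Edges of cardinality
  1 are loops; there are no parallel edges, since an edge map has to be determined by the
  underlying vertex map.\<close>

definition graph :: "'v ugraph \<Rightarrow> bool" where
  "graph G \<longleftrightarrow> finite (verts G) \<and> (\<forall>e\<in>edges G. e \<subseteq> verts G \<and> (card e = 1 \<or> card e = 2))"

definition subgraph_of :: "'v ugraph \<Rightarrow> 'v ugraph \<Rightarrow> bool" where
  "subgraph_of Y G \<longleftrightarrow> graph Y \<and> verts Y \<subseteq> verts G \<and> edges Y \<subseteq> edges G"

definition graph_iso :: "('v \<Rightarrow> 'w) \<Rightarrow> 'v ugraph \<Rightarrow> 'w ugraph \<Rightarrow> bool" where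
  "graph_iso h Y H \<longleftrightarrow>
     bij_betw h (verts Y) (verts H) \<and>
     (\<forall>u\<in>verts Y. \<forall>v\<in>verts Y. {u, v} \<in> edges Y \<longleftrightarrow> {h u, h v} \<in> edges H)"

text \<open>An edge map with domain \<open>E(Y)\<close> is a partial map, so that \<^term>\<open>dom \<pi>\<close> is
  the edge set of the copy of \<^term>\<open>H\<close>. Vertex isomorphisms inducing the same edge
  map yield one element of the isomorphism set.\<close>

definition edge_map :: "('v \<Rightarrow> 'w) \<Rightarrow> 'v ugraph \<Rightarrow> ('v set \<rightharpoonup> 'w set)" where
  "edge_map h Y = (\<lambda>e. if e \<in> edges Y then Some (h ` e) else None)"

definition iso_set :: "'v ugraph \<Rightarrow> 'w ugraph \<Rightarrow> ('v set \<rightharpoonup> 'w set) set" where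
  "iso_set G H = {edge_map h Y | h Y. subgraph_of Y G \<and> graph_iso h Y H}"

definition edge_colorings :: "'v ugraph \<Rightarrow> 'a set \<Rightarrow> ('v set \<Rightarrow> 'a) set" where
  "edge_colorings G A = edges G \<rightarrow>\<^sub>E A"

definition coprod_graph :: "'j set \<Rightarrow> ('j \<Rightarrow> 'w ugraph) \<Rightarrow> ('j \<times> 'w) ugraph" where
  "coprod_graph J H =
     \<lparr>verts = (SIGMA j:J. verts (H j)), edges = (\<Union>j\<in>J. (\<lambda>e. Pair j ` e) ` edges (H j))\<rparr>"

definition hereditary :: "('i::{wellorder,order_bot} \<Rightarrow> 'v ugraph) \<Rightarrow> bool" where
  "hereditary G \<longleftrightarrow>
     (\<forall>i k. bot < i \<and> i \<le> k \<longrightarrow> (\<forall>s<i. \<forall>t\<ge>k. iso_set (G t) (G s) \<noteq> {}))"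

definition ramsey_base ::
  "('i::{wellorder,order_bot} \<Rightarrow> 'v ugraph) \<Rightarrow> ('i \<Rightarrow> 'a set) \<Rightarrow> ('i \<Rightarrow> ('v set \<Rightarrow> 'a) set) \<Rightarrow> bool"
  where
  "ramsey_base G A S \<longleftrightarrow>
     (\<forall>i. graph (G i)) \<and> hereditary G \<and> (\<forall>i. S i \<subseteq> edge_colorings (G i) (A i))"

definition ramsey_symbol ::
  "('i::{wellorder,order_bot} \<Rightarrow> 'a set) \<Rightarrow> ('i \<Rightarrow> 'j set) \<Rightarrow> ('i \<Rightarrow> 'j \<Rightarrow> 'w ugraph)
     \<Rightarrow> ('i \<Rightarrow> 'j \<Rightarrow> 'w set \<Rightarrow> 'a) \<Rightarrow> bool"
  where
  "ramsey_symbol A J H \<psi> \<longleftrightarrow>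
     (\<forall>i. finite (J i)) \<and>
     (\<forall>i. \<forall>j\<in>J i. graph (H i j) \<and> \<psi> i j \<in> edge_colorings (H i j) (A i)) \<and>
     hereditary (\<lambda>i. coprod_graph (J i) (H i))"

definition locally_finite_type :: "('i \<Rightarrow> 'a set) \<Rightarrow> bool" where
  "locally_finite_type A \<longleftrightarrow> (\<forall>i. finite (A i))"

definition is_least :: "('i::order \<Rightarrow> bool) \<Rightarrow> 'i \<Rightarrow> bool" where
  "is_least P n \<longleftrightarrow> P n \<and> (\<forall>m. P m \<longrightarrow> n \<le> m)"

definition ramsey_bound ::
  "('i::{wellorder,order_bot} \<Rightarrow> 'v ugraph) \<Rightarrow> ('i \<Rightarrow> ('v set \<Rightarrow> 'a) set)
     \<Rightarrow> ('i \<Rightarrow> 'j set) \<Rightarrow> ('i \<Rightarrow> 'j \<Rightarrow> 'w ugraph) \<Rightarrow> ('i \<Rightarrow> 'j \<Rightarrow> 'w set \<Rightarrow> 'a) \<Rightarrow> 'i \<Rightarrow> bool"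
  where
  "ramsey_bound G S J H \<psi> n \<longleftrightarrow>
     (\<forall>t\<ge>n. \<forall>\<rho>\<in>S t. \<exists>j\<in>J t. \<exists>\<pi>\<in>iso_set (G t) (H t j).
        \<forall>e\<in>dom \<pi>. \<rho> e = \<psi> t j (the (\<pi> e)))"

text \<open>\<^term>\<open>None\<close> stands for a Ramsey number that does not exist.\<close>

definition ramsey_number ::
  "('i::{wellorder,order_bot} \<Rightarrow> 'v ugraph) \<Rightarrow> ('i \<Rightarrow> ('v set \<Rightarrow> 'a) set)
     \<Rightarrow> ('i \<Rightarrow> 'j set) \<Rightarrow> ('i \<Rightarrow> 'j \<Rightarrow> 'w ugraph) \<Rightarrow> ('i \<Rightarrow> 'j \<Rightarrow> 'w set \<Rightarrow> 'a) \<Rightarrow> 'i option"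
  where
  "ramsey_number G S J H \<psi> =
     (if \<exists>n. ramsey_bound G S J H \<psi> n then Some (LEAST n. ramsey_bound G S J H \<psi> n) else None)"

text \<open>The library provides the set of polynomials in the indeterminates \<^term>\<open>E\<close>
  (coefficient functions on monomials, a monomial being a multiset of indeterminates) and their
  addition, but no multiplication of two polynomials; here it is the convolution.\<close>

definition mpoly_mult ::
  "('k, 'r) ring_scheme \<Rightarrow> ('e multiset \<Rightarrow> 'k) \<Rightarrow> ('e multiset \<Rightarrow> 'k) \<Rightarrow> ('e multiset \<Rightarrow> 'k)" where
  "mpoly_mult K P Q = (\<lambda>m. \<Oplus>\<^bsub>K\<^esub>a\<in>{a. a \<subseteq># m}. P a \<otimes>\<^bsub>K\<^esub> Q (m - a))"

definition mpoly_ring :: "('k, 'r) ring_scheme \<Rightarrow> 'e set \<Rightarrow> ('e multiset \<Rightarrow> 'k) ring" where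
  "mpoly_ring K E =
     \<lparr>carrier = ring.indexed_pset K E (carrier K),
      monoid.mult = mpoly_mult K,
      one = ring.indexed_const K \<one>\<^bsub>K\<^esub>,
      ring.zero = ring.indexed_const K \<zero>\<^bsub>K\<^esub>,
      ring.add = ring.indexed_padd K\<rparr>"

definition mpoly_eval :: "('k, 'r) ring_scheme \<Rightarrow> ('e multiset \<Rightarrow> 'k) \<Rightarrow> ('e \<Rightarrow> 'k) \<Rightarrow> 'k" where
  "mpoly_eval K P x =
     (\<Oplus>\<^bsub>K\<^esub>m\<in>{m. P m \<noteq> \<zero>\<^bsub>K\<^esub>}.
        P m \<otimes>\<^bsub>K\<^esub> (\<Otimes>\<^bsub>K\<^esub>e\<in>set_mset m. x e [^]\<^bsub>K\<^esub> count m e))"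

definition zero_locus ::
  "('k, 'r) ring_scheme \<Rightarrow> 'e set \<Rightarrow> ('e multiset \<Rightarrow> 'k) set \<Rightarrow> ('e \<Rightarrow> 'k) set" where
  "zero_locus K E \<J> = {x \<in> E \<rightarrow>\<^sub>E carrier K. \<forall>P\<in>\<J>. mpoly_eval K P x = \<zero>\<^bsub>K\<^esub>}"

definition vanishing_ideal ::
  "('k, 'r) ring_scheme \<Rightarrow> 'e set \<Rightarrow> ('e \<Rightarrow> 'k) set \<Rightarrow> ('e multiset \<Rightarrow> 'k) set" where
  "vanishing_ideal K E U =
     {P \<in> carrier (mpoly_ring K E). \<forall>x\<in>U. mpoly_eval K P x = \<zero>\<^bsub>K\<^esub>}"

text \<open>For the field with \<open>q\<close> elements the exponent \<^term>\<open>order K - 1\<close> is \<open>q - 1\<close>.\<close>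

definition ramsey_poly1 ::
  "('k, 'r) ring_scheme \<Rightarrow> 'v ugraph \<Rightarrow> 'w ugraph \<Rightarrow> ('w set \<Rightarrow> 'k) \<Rightarrow> ('v set multiset \<Rightarrow> 'k)" where
  "ramsey_poly1 K G H \<phi> =
     (let R = mpoly_ring K (edges G) in
      \<Otimes>\<^bsub>R\<^esub>\<pi>\<in>iso_set G H.
        \<one>\<^bsub>R\<^esub> \<ominus>\<^bsub>R\<^esub>
        (\<Otimes>\<^bsub>R\<^esub>e\<in>dom \<pi>.
           \<one>\<^bsub>R\<^esub> \<ominus>\<^bsub>R\<^esub>
           (ring.indexed_var K e \<ominus>\<^bsub>R\<^esub> ring.indexed_const K (\<phi> (the (\<pi> e))))
             [^]\<^bsub>R\<^esub> (order K - 1)))"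

definition ramsey_poly ::
  "('k, 'r) ring_scheme \<Rightarrow> 'v ugraph \<Rightarrow> 'j set \<Rightarrow> ('j \<Rightarrow> 'w ugraph) \<Rightarrow> ('j \<Rightarrow> 'w set \<Rightarrow> 'k)
     \<Rightarrow> ('v set multiset \<Rightarrow> 'k)" where
  "ramsey_poly K G J H \<phi> =
     (\<Otimes>\<^bsub>mpoly_ring K (edges G)\<^esub>j\<in>J. ramsey_poly1 K G (H j) (\<phi> j))"

definition ramsey_ideal ::
  "('k, 'r) ring_scheme \<Rightarrow> 'v ugraph \<Rightarrow> 'j set \<Rightarrow> ('j \<Rightarrow> 'w ugraph) \<Rightarrow> ('j \<Rightarrow> 'w set \<Rightarrow> 'k)
     \<Rightarrow> ('v set multiset \<Rightarrow> 'k) set" where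
  "ramsey_ideal K G J H \<phi> = Idl\<^bsub>mpoly_ring K (edges G)\<^esub> {ramsey_poly K G J H \<phi>}"

end

(* Evaluation at a colouring is a ring homomorphism into the field with q elements, where
   y ^ (q - 1) is 0 for y = 0 and 1 otherwise. Hence at a colouring x the factor belonging to an
   edge map is 0 if x agrees with the given colouring along that map and 1 otherwise, and the
   product over all edge maps vanishes exactly if some copy is coloured as prescribed. Since an
   element of the generated ideal is a multiple of the generator, the ideal vanishes at x exactly
   if the generator does, so each of the two algebraic conditions is the Ramsey condition, the
   injections f_i making equality of colours before and after recolouring the same. *)

theory Submission
  imports Defs
begin

section \<open>Polynomials in indeterminates from a set: support, convolution product, ring
  laws\<close>

text \<open>Makes the convolution sums genuine finite sums; a \<open>finsum\<close> over an infinite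
  set would be zero by convention. A submultiset of \<open>add_mset x m\<close> either omits
  \<open>x\<close> or arises from a submultiset of \<open>m\<close> by adding
  \<open>x\<close>.\<close>

lemma finite_submultisets: "finite {a. a \<subseteq># m}"
proof (induction m)
  case (add x m)
  have "{a. a \<subseteq># add_mset x m} \<subseteq> {a. a \<subseteq># m} \<union> add_mset x ` {a. a \<subseteq># m}"
  proof
    fix a assume a: "a \<in> {a. a \<subseteq># add_mset x m}"
    show "a \<in> {a. a \<subseteq># m} \<union> add_mset x ` {a. a \<subseteq># m}"
    proof (cases "x \<in># a")
      case True
      then obtain b where "a = add_mset x b" by (metis mset_add)
      with a show ?thesis by auto
    next
      case False
      with a have "a - {#x#} \<subseteq># m" by (subst subset_eq_diff_conv) simp
      with False show ?thesis by (simp add: diff_single_trivial)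
    qed
  qed
  with add show ?case
    by (meson finite_UnI finite_imageI finite_subset)
qed auto

context ring
begin

lemma mpoly_ring_simps:
  "carrier (mpoly_ring R E) = indexed_pset E (carrier R)"
  "P \<otimes>\<^bsub>mpoly_ring R E\<^esub> Q = mpoly_mult R P Q"
  "\<one>\<^bsub>mpoly_ring R E\<^esub> = indexed_const \<one>"
  "\<zero>\<^bsub>mpoly_ring R E\<^esub> = indexed_const \<zero>"
  "P \<oplus>\<^bsub>mpoly_ring R E\<^esub> Q = indexed_padd P Q"
  by (simp_all add: mpoly_ring_def)

lemma indexed_pset_coeff [simp]: "P \<in> indexed_pset E (carrier R) \<Longrightarrow> P m \<in> carrier R"
  using indexed_pset_in_carrier carrier_coeffE by blast

text \<open>Needed because \<open>mpoly_eval\<close> sums over the support, and an infinite support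
  would give zero by convention.\<close>

lemma finite_indexed_pset_support:
  "P \<in> indexed_pset E (carrier R) \<Longrightarrow> finite {m. P m \<noteq> \<zero>}"
proof (induction rule: indexed_pset.induct)
  case (indexed_const k)
  have "{m. indexed_const k m \<noteq> \<zero>} \<subseteq> {{#}}" by (auto simp: indexed_const_def)
  then show ?case by (rule finite_subset) simp
next
  case (indexed_padd P Q)
  have "{m. indexed_padd P Q m \<noteq> \<zero>} \<subseteq> {m. P m \<noteq> \<zero>} \<union> {m. Q m \<noteq> \<zero>}"
    by (auto simp: indexed_padd_def)
  with indexed_padd show ?case by (meson finite_UnI finite_subset)
next
  case (indexed_pmult P i)
  have "{m. indexed_pmult P i m \<noteq> \<zero>} \<subseteq> add_mset i ` {m. P m \<noteq> \<zero>}"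
    by (auto simp: indexed_pmult_def image_iff split: if_splits)
      (metis insert_DiffM)
  with indexed_pmult show ?case by (meson finite_imageI finite_subset)
qed

text \<open>Keeps evaluation inside the carrier: a point is known to take values there only on
  \<open>E\<close>.\<close>

lemma indexed_pset_support:
  "P \<in> indexed_pset E (carrier R) \<Longrightarrow> P m \<noteq> \<zero> \<Longrightarrow> set_mset m \<subseteq> E"
proof (induction arbitrary: m rule: indexed_pset.induct)
  case (indexed_const k)
  then show ?case by (auto simp: indexed_const_def split: if_splits)
next
  case (indexed_padd P Q)
  then show ?case by (metis indexed_padd_def l_zero zero_closed)
next
  case (indexed_pmult P i)
  then have "i \<in># m" "P (m - {#i#}) \<noteq> \<zero>"
    by (auto simp: indexed_pmult_def split: if_splits)
  with indexed_pmult.IH[of "m - {#i#}"] \<open>i \<in> E\<close> show ?case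
    by (metis insert_DiffM insert_subset set_mset_add_mset_insert)
qed

text \<open>\<open>indexed_pset\<close> is generated by constants, sums and multiplication by a
  variable, so closure under scalars takes an induction. The scalar \<open>\<ominus> \<one>\<close>
  will supply additive inverses.\<close>

lemma indexed_pset_smult:
  "P \<in> indexed_pset E (carrier R) \<Longrightarrow> k \<in> carrier R
    \<Longrightarrow> (\<lambda>m. k \<otimes> P m) \<in> indexed_pset E (carrier R)"
proof (induction rule: indexed_pset.induct)
  case (indexed_const l)
  then have *: "(\<lambda>m. k \<otimes> indexed_const l m) = indexed_const (k \<otimes> l)"
    by (auto simp: indexed_const_def)
  show ?case
    unfolding * by (intro indexed_pset.indexed_const m_closed indexed_const)
next
  case (indexed_padd P Q)
  then have "(\<lambda>m. k \<otimes> indexed_padd P Q m) = indexed_padd (\<lambda>m. k \<otimes> P m) (\<lambda>m. k \<otimes> Q m)"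
    by (simp add: indexed_padd_def r_distr)
  with indexed_padd show ?case by (simp add: indexed_pset.indexed_padd)
next
  case (indexed_pmult P i)
  then have "(\<lambda>m. k \<otimes> indexed_pmult P i m) = indexed_pmult (\<lambda>m. k \<otimes> P m) i"
    by (auto simp: indexed_pmult_def)
  with indexed_pmult show ?case by (simp add: indexed_pset.indexed_pmult)
qed

text \<open>First of three rules that compute a product along the constructors of
  \<open>indexed_pset\<close> in its left factor. Here only the empty submultiset contributes to the
  convolution.\<close>

lemma mpoly_mult_const:
  assumes "k \<in> carrier R" "\<And>m. Q m \<in> carrier R"
  shows "mpoly_mult R (indexed_const k) Q = (\<lambda>m. k \<otimes> Q m)"
proof
  fix m
  have "mpoly_mult R (indexed_const k) Q m = (\<Oplus>a\<in>{{#}}. k \<otimes> Q (m - a))"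
    unfolding mpoly_mult_def
    by (rule add.finprod_mono_neutral_cong_right)
      (use assms in \<open>auto simp: finite_submultisets indexed_const_def\<close>)
  also have "\<dots> = k \<otimes> Q m" using assms by simp
  finally show "mpoly_mult R (indexed_const k) Q m = k \<otimes> Q m" .
qed

lemma mpoly_mult_padd:
  assumes "\<And>m. P m \<in> carrier R" "\<And>m. P' m \<in> carrier R" "\<And>m. Q m \<in> carrier R"
  shows "mpoly_mult R (indexed_padd P P') Q = indexed_padd (mpoly_mult R P Q) (mpoly_mult R P' Q)"
proof
  fix m
  have "(\<Oplus>a\<in>{a. a \<subseteq># m}. (P a \<oplus> P' a) \<otimes> Q (m - a)) =
      (\<Oplus>a\<in>{a. a \<subseteq># m}. P a \<otimes> Q (m - a) \<oplus> P' a \<otimes> Q (m - a))"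
    by (rule add.finprod_cong') (use assms in \<open>auto simp: l_distr\<close>)
  also have "\<dots> = (\<Oplus>a\<in>{a. a \<subseteq># m}. P a \<otimes> Q (m - a)) \<oplus> (\<Oplus>a\<in>{a. a \<subseteq># m}. P' a \<otimes> Q (m - a))"
    by (rule add.finprod_multf) (use assms in auto)
  finally show "mpoly_mult R (indexed_padd P P') Q m =
      indexed_padd (mpoly_mult R P Q) (mpoly_mult R P' Q) m"
    by (simp add: mpoly_mult_def indexed_padd_def)
qed

lemma mpoly_mult_pmult:
  assumes P: "\<And>m. P m \<in> carrier R" and Q: "\<And>m. Q m \<in> carrier R"
  shows "mpoly_mult R (indexed_pmult P i) Q = indexed_pmult (mpoly_mult R P Q) i"
proof
  fix m
  show "mpoly_mult R (indexed_pmult P i) Q m = indexed_pmult (mpoly_mult R P Q) i m"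
  proof (cases "i \<in># m")
    case True
    \<comment> \<open>These are the submultisets of \<open>m\<close> that contain \<open>i\<close>;
      at all others \<open>indexed_pmult P i\<close> has coefficient zero. Removing one
      \<open>i\<close> turns the sum over them into the convolution at
      \<open>m - {#i#}\<close>.\<close>
    let ?D = "add_mset i ` {a. a \<subseteq># m - {#i#}}"
    have sub: "add_mset i a \<subseteq># m" if "a \<subseteq># m - {#i#}" for a
      using that True by (metis insert_DiffM mset_subset_eq_add_mset_cancel)
    have sub': "a \<in> ?D" if "a \<subseteq># m" "i \<in># a" for a
      using that mset_subset_eqD[OF that]
      by (intro image_eqI[of _ _ "a - {#i#}"]) (simp_all add: subset_eq_diff_conv)
    have "mpoly_mult R (indexed_pmult P i) Q m = (\<Oplus>a\<in>?D. P (a - {#i#}) \<otimes> Q (m - a))"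
      unfolding mpoly_mult_def
      by (rule add.finprod_mono_neutral_cong_right)
        (use P Q sub sub' in \<open>auto simp: finite_submultisets indexed_pmult_def\<close>)
    also have "\<dots> = (\<Oplus>a\<in>{a. a \<subseteq># m - {#i#}}. P (add_mset i a - {#i#}) \<otimes> Q (m - add_mset i a))"
      by (rule add.finprod_reindex) (use P Q in \<open>auto simp: inj_on_def\<close>)
    also have "\<dots> = indexed_pmult (mpoly_mult R P Q) i m"
      using True by (simp add: indexed_pmult_def mpoly_mult_def)
    finally show ?thesis .
  next
    case False
    then have "mpoly_mult R (indexed_pmult P i) Q m = (\<Oplus>a\<in>{a. a \<subseteq># m}. \<zero>)"
      unfolding mpoly_mult_def
      by (intro add.finprod_cong')
        (use Q in \<open>auto simp: indexed_pmult_def dest: mset_subset_eqD\<close>)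
    with False show ?thesis by (simp add: indexed_pmult_def)
  qed
qed

lemma mpoly_mult_closed:
  assumes "P \<in> indexed_pset E (carrier R)" and "Q \<in> indexed_pset E (carrier R)"
  shows "mpoly_mult R P Q \<in> indexed_pset E (carrier R)"
  using assms
proof (induction rule: indexed_pset.induct)
  case (indexed_const k)
  then show ?case by (simp add: mpoly_mult_const indexed_pset_smult)
next
  case (indexed_padd P P')
  then have "mpoly_mult R (indexed_padd P P') Q
      = indexed_padd (mpoly_mult R P Q) (mpoly_mult R P' Q)"
    by (intro mpoly_mult_padd) auto
  with indexed_padd show ?case by (simp add: indexed_pset.indexed_padd)
next
  case (indexed_pmult P i)
  then have "mpoly_mult R (indexed_pmult P i) Q = indexed_pmult (mpoly_mult R P Q) i"
    by (intro mpoly_mult_pmult) auto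
  with indexed_pmult show ?case by (simp add: indexed_pset.indexed_pmult)
qed

text \<open>Each law of multiplication is checked on the generators of \<^const>\<open>indexed_pset\<close>, which
  avoids all manipulation of double sums over submultisets.\<close>

lemma mpoly_mult_assoc:
  assumes "P \<in> indexed_pset E (carrier R)"
    and Q: "Q \<in> indexed_pset E (carrier R)" and S: "S \<in> indexed_pset E (carrier R)"
  shows "mpoly_mult R (mpoly_mult R P Q) S = mpoly_mult R P (mpoly_mult R Q S)"
  using assms(1)
proof (induction rule: indexed_pset.induct)
  case (indexed_const k)
  have "mpoly_mult R (\<lambda>m. k \<otimes> Q m) S m = k \<otimes> mpoly_mult R Q S m" for m
  proof -
    have "mpoly_mult R (\<lambda>m. k \<otimes> Q m) S m = (\<Oplus>a\<in>{a. a \<subseteq># m}. k \<otimes> (Q a \<otimes> S (m - a)))"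
      unfolding mpoly_mult_def
      by (rule add.finprod_cong') (use indexed_const Q S in \<open>auto simp: m_assoc\<close>)
    also have "\<dots> = k \<otimes> mpoly_mult R Q S m"
      unfolding mpoly_mult_def
      by (rule finsum_rdistr[symmetric])
        (use indexed_const Q S in \<open>auto simp: finite_submultisets\<close>)
    finally show ?thesis .
  qed
  moreover have "mpoly_mult R (indexed_const k) Q = (\<lambda>m. k \<otimes> Q m)"
    "mpoly_mult R (indexed_const k) (mpoly_mult R Q S) = (\<lambda>m. k \<otimes> mpoly_mult R Q S m)"
    using indexed_const indexed_pset_coeff[OF Q] indexed_pset_coeff[OF mpoly_mult_closed[OF Q S]]
    by (simp_all add: mpoly_mult_const)
  ultimately show ?case by (simp add: fun_eq_iff)
next
  case (indexed_padd P P')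
  note [simp] = indexed_pset_coeff[OF Q] indexed_pset_coeff[OF S]
    indexed_pset_coeff[OF indexed_padd.hyps(1)] indexed_pset_coeff[OF indexed_padd.hyps(2)]
    indexed_pset_coeff[OF mpoly_mult_closed[OF indexed_padd.hyps(1) Q]]
    indexed_pset_coeff[OF mpoly_mult_closed[OF indexed_padd.hyps(2) Q]]
    indexed_pset_coeff[OF mpoly_mult_closed[OF Q S]]
  show ?case by (simp add: mpoly_mult_padd indexed_padd.IH)
next
  case (indexed_pmult P i)
  note [simp] = indexed_pset_coeff[OF Q] indexed_pset_coeff[OF S]
    indexed_pset_coeff[OF indexed_pmult.hyps(1)]
    indexed_pset_coeff[OF mpoly_mult_closed[OF indexed_pmult.hyps(1) Q]]
    indexed_pset_coeff[OF mpoly_mult_closed[OF Q S]]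
  show ?case by (simp add: mpoly_mult_pmult indexed_pmult.IH)
qed

end

text \<open>Taking complements \<open>m - a\<close> is an involution on the submultisets of
  \<open>m\<close> and exchanges the arguments of the two factors in every summand.\<close>

lemma (in cring) mpoly_mult_comm:
  fixes P Q :: "'c multiset \<Rightarrow> 'a"
  assumes "\<And>m. P m \<in> carrier R" "\<And>m. Q m \<in> carrier R"
  shows "mpoly_mult R P Q = mpoly_mult R Q P"
proof
  fix m :: "'c multiset"
  have sub: "m - (m - a) = a" if "a \<subseteq># m" for a
    using that by (auto simp: subset_mset.le_iff_add)
  have "(\<lambda>a. m - a) ` {a. a \<subseteq># m} = {a. a \<subseteq># m}"
  proof (intro equalityI subsetI)
    fix a assume "a \<in> {a. a \<subseteq># m}"
    then show "a \<in> (\<lambda>a. m - a) ` {a. a \<subseteq># m}"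
      by (intro image_eqI[of _ _ "m - a"]) (simp_all add: sub)
  qed auto
  then have "mpoly_mult R P Q m = (\<Oplus>a\<in>(\<lambda>a. m - a) ` {a. a \<subseteq># m}. P a \<otimes> Q (m - a))"
    by (simp add: mpoly_mult_def)
  also have "\<dots> = (\<Oplus>a\<in>{a. a \<subseteq># m}. P (m - a) \<otimes> Q (m - (m - a)))"
  proof (rule add.finprod_reindex)
    show "inj_on (\<lambda>a. m - a) {a. a \<subseteq># m}"
      by (rule inj_on_inverseI[of _ "\<lambda>a. m - a"]) (simp add: sub)
  qed (use assms in auto)
  also have "\<dots> = mpoly_mult R Q P m"
    unfolding mpoly_mult_def
    by (rule add.finprod_cong') (use assms in \<open>auto simp: sub m_comm\<close>)
  finally show "mpoly_mult R P Q m = mpoly_mult R Q P m" .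
qed

text \<open>Given commutativity, the unit and distributive laws are required on one side only, and
  these are the sides covered by the rules for the left factor.\<close>

lemma (in cring) cring_mpoly_ring: "cring (mpoly_ring R E)"
proof (rule cringI)
  note [simp] = mpoly_ring_simps
  show "abelian_group (mpoly_ring R E)"
  proof (rule abelian_groupI, goal_cases)
    case (6 P)
    \<comment> \<open>The additive inverse is written as a scalar multiple so that
      \<open>indexed_pset_smult\<close> places it in the carrier.\<close>
    have "indexed_padd (\<lambda>m. \<ominus> \<one> \<otimes> P m) P = indexed_const \<zero>"
      using 6 by (auto simp: indexed_padd_def indexed_zero_def l_minus l_neg)
    with 6 show ?case by (auto intro!: bexI[of _ "\<lambda>m. \<ominus> \<one> \<otimes> P m"] indexed_pset_smult)
  next
    case (3 P Q S)
    then show ?case by (simp add: indexed_padd_def a_assoc)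
  next
    case (4 P Q)
    then show ?case by (simp add: indexed_padd_def a_comm)
  next
    case (5 P)
    then show ?case by (simp add: indexed_padd_def indexed_zero_def)
  qed (simp_all add: indexed_pset.indexed_padd indexed_pset.indexed_const)
  show "comm_monoid (mpoly_ring R E)"
  proof (rule comm_monoidI)
    fix P Q assume "P \<in> carrier (mpoly_ring R E)" "Q \<in> carrier (mpoly_ring R E)"
    then show "P \<otimes>\<^bsub>mpoly_ring R E\<^esub> Q = Q \<otimes>\<^bsub>mpoly_ring R E\<^esub> P"
      by (simp add: mpoly_mult_comm)
  qed (simp_all add: mpoly_mult_closed mpoly_mult_assoc mpoly_mult_const
      indexed_pset.indexed_const)
qed (simp add: mpoly_ring_simps mpoly_mult_padd)

section \<open>Evaluation at a point as a ring homomorphism\<close>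

context cring
begin

definition monomial_eval :: "('c \<Rightarrow> 'a) \<Rightarrow> 'c multiset \<Rightarrow> 'a" where
  "monomial_eval x m = (\<Otimes>e\<in>set_mset m. x e [^] count m e)"

lemma monomial_eval_closed: "x \<in> set_mset m \<rightarrow> carrier R \<Longrightarrow> monomial_eval x m \<in> carrier R"
  unfolding monomial_eval_def by (rule finprod_closed) auto

lemma monomial_eval_add_mset:
  assumes x: "x \<in> insert i (set_mset m) \<rightarrow> carrier R"
  shows "monomial_eval x (add_mset i m) = monomial_eval x m \<otimes> x i"
proof -
  let ?A = "insert i (set_mset m)"
  have xc: "x e \<in> carrier R" if "e \<in> ?A" for e using x that by blast
  \<comment> \<open>The additional factor \<open>x i\<close> is spread over the whole index set as a
    product with all other factors one, so that both products run over the same set.\<close>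
  have "monomial_eval x (add_mset i m)
      = (\<Otimes>e\<in>?A. x e [^] count m e \<otimes> (if i = e then x e else \<one>))"
    unfolding monomial_eval_def set_mset_add_mset_insert
    by (rule finprod_cong') (use xc in auto)
  also have "\<dots> = (\<Otimes>e\<in>?A. x e [^] count m e) \<otimes> (\<Otimes>e\<in>?A. if i = e then x e else \<one>)"
    by (rule finprod_multf) (use xc in auto)
  also have "(\<Otimes>e\<in>?A. if i = e then x e else \<one>) = x i"
    by (rule finprod_singleton) (use xc in auto)
  \<comment> \<open>If \<open>i\<close> does not occur in \<open>m\<close>, the index set shrinks,
    but the lost factor has exponent zero and equals one.\<close>
  also have "(\<Otimes>e\<in>?A. x e [^] count m e) = monomial_eval x m"
    unfolding monomial_eval_def
    by (rule finprod_mono_neutral_cong_right) (use xc in \<open>auto simp: not_in_iff\<close>)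
  finally show ?thesis .
qed

text \<open>Monomials with coefficient zero contribute nothing, so the support may be enlarged. This
  lets polynomials with different supports be summed over one common set.\<close>

lemma mpoly_eval_eq_finsum:
  assumes "P \<in> indexed_pset E (carrier R)" "x \<in> E \<rightarrow> carrier R"
    and "finite M" "{m. P m \<noteq> \<zero>} \<subseteq> M" "\<And>m. m \<in> M \<Longrightarrow> set_mset m \<subseteq> E"
  shows "mpoly_eval R P x = (\<Oplus>m\<in>M. P m \<otimes> monomial_eval x m)"
proof -
  have "monomial_eval x m \<in> carrier R" if "m \<in> M" for m
    using assms(2,5) that by (intro monomial_eval_closed) blast
  then show ?thesis
    unfolding mpoly_eval_def monomial_eval_def[symmetric]
    using assms by (intro add.finprod_mono_neutral_cong_left) auto
qed

context
  fixes E :: "'c set" and x :: "'c \<Rightarrow> 'a"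
  assumes x: "x \<in> E \<rightarrow> carrier R"
begin

lemma mpoly_eval_closed:
  assumes P: "P \<in> indexed_pset E (carrier R)"
  shows "mpoly_eval R P x \<in> carrier R"
  unfolding mpoly_eval_def monomial_eval_def[symmetric]
proof (rule finsum_closed, rule Pi_I)
  fix m assume "m \<in> {m. P m \<noteq> \<zero>}"
  then have "set_mset m \<subseteq> E" using indexed_pset_support[OF P] by blast
  then have "monomial_eval x m \<in> carrier R"
    using x by (intro monomial_eval_closed) blast
  then show "P m \<otimes> monomial_eval x m \<in> carrier R"
    using P by simp
qed

lemma mpoly_eval_const:
  assumes k: "k \<in> carrier R"
  shows "mpoly_eval R (indexed_const k) x = k"
proof -
  have "{m. indexed_const k m \<noteq> \<zero>} \<subseteq> {{#}}"
    by (auto simp: indexed_const_def)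
  from mpoly_eval_eq_finsum[OF indexed_pset.indexed_const[OF k] x _ this] show ?thesis
    using k by (simp add: indexed_const_def monomial_eval_def)
qed

lemma mpoly_eval_padd:
  assumes P: "P \<in> indexed_pset E (carrier R)" and Q: "Q \<in> indexed_pset E (carrier R)"
  shows "mpoly_eval R (indexed_padd P Q) x = mpoly_eval R P x \<oplus> mpoly_eval R Q x"
proof -
  \<comment> \<open>The support of the sum may be smaller by cancellation, hence the union of both
    supports serves as index set.\<close>
  let ?M = "{m. P m \<noteq> \<zero>} \<union> {m. Q m \<noteq> \<zero>}"
  have fin: "finite ?M"
    using P Q by (simp add: finite_indexed_pset_support)
  have sub: "set_mset m \<subseteq> E" if "m \<in> ?M" for m
    using that indexed_pset_support[OF P] indexed_pset_support[OF Q] by blast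
  have mon: "monomial_eval x m \<in> carrier R" if "m \<in> ?M" for m
    using x sub[OF that] by (intro monomial_eval_closed) blast
  have coeff: "P m \<in> carrier R" "Q m \<in> carrier R" for m
    using P Q by auto
  have "mpoly_eval R (indexed_padd P Q) x = (\<Oplus>m\<in>?M. indexed_padd P Q m \<otimes> monomial_eval x m)"
    using sub fin
    by (intro mpoly_eval_eq_finsum[OF indexed_pset.indexed_padd[OF P Q] x])
      (auto simp: indexed_padd_def)
  also have "\<dots> = (\<Oplus>m\<in>?M. P m \<otimes> monomial_eval x m \<oplus> Q m \<otimes> monomial_eval x m)"
    using mon coeff by (intro add.finprod_cong') (auto simp: indexed_padd_def l_distr)
  also have "\<dots> = (\<Oplus>m\<in>?M. P m \<otimes> monomial_eval x m) \<oplus> (\<Oplus>m\<in>?M. Q m \<otimes> monomial_eval x m)"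
    using mon coeff by (intro add.finprod_multf) auto
  also have "(\<Oplus>m\<in>?M. P m \<otimes> monomial_eval x m) = mpoly_eval R P x"
    by (rule mpoly_eval_eq_finsum[OF P x fin _ sub, symmetric]) auto
  also have "(\<Oplus>m\<in>?M. Q m \<otimes> monomial_eval x m) = mpoly_eval R Q x"
    by (rule mpoly_eval_eq_finsum[OF Q x fin _ sub, symmetric]) auto
  finally show ?thesis .
qed

lemma mpoly_eval_pmult:
  assumes P: "P \<in> indexed_pset E (carrier R)" and i: "i \<in> E"
  shows "mpoly_eval R (indexed_pmult P i) x = mpoly_eval R P x \<otimes> x i"
proof -
  let ?M = "{m. P m \<noteq> \<zero>}"
  have fin: "finite ?M"
    using P by (simp add: finite_indexed_pset_support)
  have sub: "set_mset m \<subseteq> E" if "m \<in> ?M" for m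
    using that indexed_pset_support[OF P] by blast
  have mon: "monomial_eval x m \<in> carrier R" if "m \<in> ?M" for m
    using x sub[OF that] by (intro monomial_eval_closed) blast
  have mon': "monomial_eval x (add_mset i m) = monomial_eval x m \<otimes> x i" if "m \<in> ?M" for m
    using x i sub[OF that] by (intro monomial_eval_add_mset) blast
  have xi: "x i \<in> carrier R" using x i by blast
  have coeff: "P m \<in> carrier R" for m
    using P by auto
  have supp: "{m. indexed_pmult P i m \<noteq> \<zero>} \<subseteq> add_mset i ` ?M"
  proof
    fix m assume "m \<in> {m. indexed_pmult P i m \<noteq> \<zero>}"
    then show "m \<in> add_mset i ` ?M"
      by (intro image_eqI[of _ _ "m - {#i#}"]) (auto simp: indexed_pmult_def split: if_splits)
  qed
  have "mpoly_eval R (indexed_pmult P i) x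
      = (\<Oplus>m\<in>add_mset i ` ?M. indexed_pmult P i m \<otimes> monomial_eval x m)"
  proof (rule mpoly_eval_eq_finsum[OF indexed_pset.indexed_pmult[OF P i] x _ supp])
    show "set_mset m \<subseteq> E" if "m \<in> add_mset i ` ?M" for m
      using that i sub by fastforce
  qed (use fin in simp)
  also have "\<dots> = (\<Oplus>m\<in>?M. indexed_pmult P i (add_mset i m) \<otimes> monomial_eval x (add_mset i m))"
    using mon coeff xi
    by (intro add.finprod_reindex) (auto simp: inj_on_def mon' indexed_pmult_def)
  also have "\<dots> = (\<Oplus>m\<in>?M. P m \<otimes> monomial_eval x m \<otimes> x i)"
    using mon coeff xi by (intro add.finprod_cong') (auto simp: indexed_pmult_def mon' m_assoc)
  also have "\<dots> = mpoly_eval R P x \<otimes> x i"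
    unfolding mpoly_eval_def monomial_eval_def[symmetric]
    using mon coeff xi fin by (intro finsum_ldistr[symmetric]) auto
  finally show ?thesis .
qed

text \<open>The constant case of multiplicativity. The sum stays over the support of
  \<open>P\<close>, since some products \<open>k \<otimes> P m\<close> may vanish.\<close>

lemma mpoly_eval_smult:
  assumes P: "P \<in> indexed_pset E (carrier R)" and k: "k \<in> carrier R"
  shows "mpoly_eval R (\<lambda>m. k \<otimes> P m) x = k \<otimes> mpoly_eval R P x"
proof -
  let ?M = "{m. P m \<noteq> \<zero>}"
  have fin: "finite ?M"
    using P by (simp add: finite_indexed_pset_support)
  have sub: "set_mset m \<subseteq> E" if "m \<in> ?M" for m
    using that indexed_pset_support[OF P] by blast
  have mon: "monomial_eval x m \<in> carrier R" if "m \<in> ?M" for m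
    using x sub[OF that] by (intro monomial_eval_closed) blast
  have coeff: "P m \<in> carrier R" for m
    using P by auto
  have "mpoly_eval R (\<lambda>m. k \<otimes> P m) x = (\<Oplus>m\<in>?M. (k \<otimes> P m) \<otimes> monomial_eval x m)"
    using fin sub k by (intro mpoly_eval_eq_finsum[OF indexed_pset_smult[OF P k] x]) auto
  also have "\<dots> = (\<Oplus>m\<in>?M. k \<otimes> (P m \<otimes> monomial_eval x m))"
    using mon coeff k by (intro add.finprod_cong') (auto simp: m_assoc)
  also have "\<dots> = k \<otimes> mpoly_eval R P x"
    unfolding mpoly_eval_def monomial_eval_def[symmetric]
    using mon coeff k fin by (intro finsum_rdistr[symmetric]) auto
  finally show ?thesis .
qed

text \<open>Induction on the left factor reduces the product to scalar multiples, sums and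
  multiplication by a variable, for each of which evaluation is already known.\<close>

lemma mpoly_eval_mult:
  assumes "P \<in> indexed_pset E (carrier R)" and Q: "Q \<in> indexed_pset E (carrier R)"
  shows "mpoly_eval R (mpoly_mult R P Q) x = mpoly_eval R P x \<otimes> mpoly_eval R Q x"
  using assms(1)
proof (induction rule: indexed_pset.induct)
  case (indexed_const k)
  then show ?case
    by (simp add: mpoly_mult_const indexed_pset_coeff[OF Q] mpoly_eval_smult[OF Q] mpoly_eval_const)
next
  case (indexed_padd P P')
  note PQ = mpoly_mult_closed[OF indexed_padd.hyps(1) Q] mpoly_mult_closed[OF indexed_padd.hyps(2) Q]
  have "mpoly_mult R (indexed_padd P P') Q = indexed_padd (mpoly_mult R P Q) (mpoly_mult R P' Q)"
    using indexed_padd.hyps Q by (intro mpoly_mult_padd) auto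
  then show ?case
    using indexed_padd PQ Q by (simp add: mpoly_eval_padd mpoly_eval_closed l_distr)
next
  case (indexed_pmult P i)
  have "mpoly_mult R (indexed_pmult P i) Q = indexed_pmult (mpoly_mult R P Q) i"
    using indexed_pmult.hyps Q by (intro mpoly_mult_pmult) auto
  moreover have "x i \<in> carrier R" using x indexed_pmult.hyps by blast
  ultimately show ?case
    using indexed_pmult mpoly_mult_closed[OF indexed_pmult.hyps(1) Q] Q
    by (simp add: mpoly_eval_pmult mpoly_eval_closed m_ac)
qed

text \<open>In this form \<open>hom_finprod\<close> moves evaluation through the nested products of
  the Ramsey polynomial.\<close>

lemma mpoly_eval_hom: "ring_hom_cring (mpoly_ring R E) R (\<lambda>P. mpoly_eval R P x)"
proof (intro ring_hom_cring.intro ring_hom_cring_axioms.intro cring_mpoly_ring is_cring)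
  show "(\<lambda>P. mpoly_eval R P x) \<in> ring_hom (mpoly_ring R E) R"
    by (rule ring_hom_memI)
      (simp_all add: mpoly_ring_simps mpoly_eval_closed mpoly_eval_mult mpoly_eval_padd mpoly_eval_const)
qed

end

lemma indexed_var_closed: "i \<in> E \<Longrightarrow> indexed_var i \<in> indexed_pset E (carrier R)"
  unfolding indexed_var_def by (intro indexed_pset.intros) auto

lemma mpoly_eval_var:
  assumes "x \<in> E \<rightarrow> carrier R" "i \<in> E"
  shows "mpoly_eval R (indexed_var i) x = x i"
proof -
  have "x i \<in> carrier R" using assms by blast
  with assms show ?thesis
    by (simp add: indexed_var_def mpoly_eval_pmult[of x E] mpoly_eval_const[of x E]
        indexed_pset.indexed_const)
qed

end

section \<open>Zeros of products and powers in a finite field\<close>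

text \<open>Absence of zero divisors extends to products by induction. Finiteness matters: a product
  over an infinite set is one by convention, whatever its factors.\<close>

lemma (in domain) finprod_eq_zero_iff:
  assumes "finite A" "f \<in> A \<rightarrow> carrier R"
  shows "finprod R f A = \<zero> \<longleftrightarrow> (\<exists>a\<in>A. f a = \<zero>)"
  using assms by (induction A) (auto simp: Pi_def integral_iff)

text \<open>The nonzero elements form a group of order \<open>order R - 1\<close>, so each of them
  has that power equal to one.\<close>

lemma (in field) pow_order_minus_one:
  assumes "finite (carrier R)" "a \<in> carrier R"
  shows "a [^] (order R - 1) = (if a = \<zero> then \<zero> else \<one>)"
proof -
  have units: "card (Units R) = order R - 1"
    using assms(1) by (simp add: field_Units order_def)
  \<comment> \<open>The exponent must be positive for the power of zero to be zero rather than one;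
    zero and one are distinct elements.\<close>
  have "order R - 1 \<noteq> 0"
    using assms(1) card_mono[of "carrier R" "{\<zero>, \<one>}"] by (auto simp: order_def)
  then show ?thesis
    using assms units_power_order_eq_one[of a] units
    by (auto simp: field_Units nat_pow_zero)
qed

section \<open>Edge maps of copies of a graph\<close>

lemma dom_iso_set: "\<pi> \<in> iso_set G H \<Longrightarrow> dom \<pi> \<subseteq> edges G"
  by (auto simp: iso_set_def subgraph_of_def edge_map_def split: if_splits)

lemma finite_edges: "graph G \<Longrightarrow> finite (edges G)"
  unfolding graph_def by (rule finite_subset[of _ "Pow (verts G)"]) auto

text \<open>\<open>graph_iso\<close> speaks of pairs of vertices only, so an edge is first written
  as \<open>{u, v}\<close>, with \<open>u = v\<close> for a loop.\<close>

lemma ran_iso_set: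
  assumes "\<pi> \<in> iso_set G H" "e \<in> dom \<pi>"
  shows "the (\<pi> e) \<in> edges H"
proof -
  obtain h Y where Y: "\<pi> = edge_map h Y" "graph Y" "graph_iso h Y H"
    using assms(1) by (auto simp: iso_set_def subgraph_of_def)
  with assms(2) have e: "e \<in> edges Y" "the (\<pi> e) = h ` e"
    by (auto simp: edge_map_def split: if_splits)
  with Y(2) have "e \<subseteq> verts Y" "card e = 1 \<or> card e = 2"
    by (auto simp: graph_def)
  then obtain u v where "e = {u, v}" "u \<in> verts Y" "v \<in> verts Y"
    by (auto simp: card_1_singleton_iff card_2_iff)
  with e Y(3) show ?thesis
    by (auto simp: graph_iso_def)
qed

text \<open>Makes the product over all copies a finite one: edge maps are partial maps between
  finite edge sets.\<close>

lemma finite_iso_set: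
  assumes "graph G" "graph H"
  shows "finite (iso_set G H)"
proof (rule finite_subset)
  show "iso_set G H \<subseteq> {\<pi>. dom \<pi> \<subseteq> edges G \<and> ran \<pi> \<subseteq> edges H}"
    using dom_iso_set ran_iso_set by (fastforce simp: ran_def)
  \<comment> \<open>Sorted by domain, because \<open>finite_set_of_finite_maps\<close> counts maps
    with one fixed domain.\<close>
  have "{\<pi>. dom \<pi> \<subseteq> edges G \<and> ran \<pi> \<subseteq> edges H}
      = (\<Union>D\<in>Pow (edges G). {\<pi>. dom \<pi> = D \<and> ran \<pi> \<subseteq> edges H})" by auto
  then show "finite {\<pi>. dom \<pi> \<subseteq> edges G \<and> ran \<pi> \<subseteq> edges H}"
    using assms by (auto intro!: finite_set_of_finite_maps finite_edges intro: finite_subset)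
qed

section \<open>Zeros of the Ramsey polynomials\<close>

context field
begin

context
  fixes G :: "'v ugraph" and x :: "'v set \<Rightarrow> 'a"
  assumes fin: "finite (carrier R)" and G: "graph G" and x: "x \<in> edges G \<rightarrow> carrier R"
begin

interpretation ev: ring_hom_cring "mpoly_ring R (edges G)" R "\<lambda>P. mpoly_eval R P x"
  by (rule mpoly_eval_hom[OF x])

text \<open>Both claims are proved together, since evaluation may be moved through a product only
  when its factors lie in the polynomial ring.\<close>

lemma ramsey_poly1_eval:
  fixes H :: "'w ugraph" and \<phi> :: "'w set \<Rightarrow> 'a"
  assumes H: "graph H" and \<phi>: "\<phi> \<in> edges H \<rightarrow> carrier R"
  shows "ramsey_poly1 R G H \<phi> \<in> carrier (mpoly_ring R (edges G))"
    and "mpoly_eval R (ramsey_poly1 R G H \<phi>) x = \<zero>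
      \<longleftrightarrow> (\<exists>\<pi>\<in>iso_set G H. \<forall>e\<in>dom \<pi>. x e = \<phi> (the (\<pi> e)))"
proof -
  let ?R = "mpoly_ring R (edges G)"
  let ?ev = "\<lambda>P. mpoly_eval R P x"
  have pow: "?ev (P [^]\<^bsub>?R\<^esub> k) = ?ev P [^] k" if "P \<in> carrier ?R" for P and k :: nat
    using that by (induction k) auto
  \<comment> \<open>\<open>g \<pi> e\<close> will evaluate to the indicator of agreement at the edge
    \<open>e\<close>; \<open>f \<pi>\<close> is one minus the product of these, the factor of the
    copy \<open>\<pi>\<close>.\<close>
  define g :: "('v set \<rightharpoonup> 'w set) \<Rightarrow> 'v set \<Rightarrow> 'v set multiset \<Rightarrow> 'a"
    where "g \<pi> e = \<one>\<^bsub>?R\<^esub> \<ominus>\<^bsub>?R\<^esub>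
      (indexed_var e \<ominus>\<^bsub>?R\<^esub> indexed_const (\<phi> (the (\<pi> e)))) [^]\<^bsub>?R\<^esub> (order R - 1)" for \<pi> e
  define f where "f \<pi> = \<one>\<^bsub>?R\<^esub> \<ominus>\<^bsub>?R\<^esub> (\<Otimes>\<^bsub>?R\<^esub>e\<in>dom \<pi>. g \<pi> e)" for \<pi>
  have poly: "ramsey_poly1 R G H \<phi> = (\<Otimes>\<^bsub>?R\<^esub>\<pi>\<in>iso_set G H. f \<pi>)"
    by (simp add: ramsey_poly1_def f_def g_def Let_def)
  have g: "g \<pi> e \<in> carrier ?R \<and> ?ev (g \<pi> e) = (if x e = \<phi> (the (\<pi> e)) then \<one> else \<zero>)"
    if \<pi>: "\<pi> \<in> iso_set G H" and e: "e \<in> dom \<pi>" for \<pi> e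
  proof -
    have "e \<in> edges G" "the (\<pi> e) \<in> edges H"
      using dom_iso_set[OF \<pi>] ran_iso_set[OF \<pi> e] e by auto
    moreover from this have xe: "x e \<in> carrier R" and \<phi>e: "\<phi> (the (\<pi> e)) \<in> carrier R"
      using x \<phi> by auto
    ultimately have c: "indexed_var e \<in> carrier ?R" "indexed_const (\<phi> (the (\<pi> e))) \<in> carrier ?R"
      "?ev (indexed_var e) = x e" "?ev (indexed_const (\<phi> (the (\<pi> e)))) = \<phi> (the (\<pi> e))"
      by (simp_all add: mpoly_ring_simps indexed_var_closed indexed_pset.indexed_const
          mpoly_eval_var[OF x] mpoly_eval_const[OF x])
    then have "?ev (g \<pi> e) = \<one> \<ominus> (x e \<ominus> \<phi> (the (\<pi> e))) [^] (order R - 1)"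
      by (simp add: g_def a_minus_def pow)
    also have "(x e \<ominus> \<phi> (the (\<pi> e))) [^] (order R - 1)
        = (if x e = \<phi> (the (\<pi> e)) then \<zero> else \<one>)"
      using pow_order_minus_one[OF fin minus_closed[OF xe \<phi>e]] xe \<phi>e by simp
    also have "\<one> \<ominus> \<dots> = (if x e = \<phi> (the (\<pi> e)) then \<one> else \<zero>)"
      by (simp add: a_minus_def r_neg)
    finally show ?thesis
      using c(1,2) by (simp add: g_def)
  qed
  have f: "f \<pi> \<in> carrier ?R \<and> (?ev (f \<pi>) = \<zero> \<longleftrightarrow> (\<forall>e\<in>dom \<pi>. x e = \<phi> (the (\<pi> e))))"
    if \<pi>: "\<pi> \<in> iso_set G H" for \<pi>
  proof -
    have dom: "finite (dom \<pi>)"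
      using dom_iso_set[OF \<pi>] finite_edges[OF G] by (rule finite_subset)
    have gc: "g \<pi> \<in> dom \<pi> \<rightarrow> carrier ?R"
      using g[OF \<pi>] by blast
    let ?p = "\<Otimes>e\<in>dom \<pi>. if x e = \<phi> (the (\<pi> e)) then \<one> else \<zero>"
    have "?ev (\<Otimes>\<^bsub>?R\<^esub>e\<in>dom \<pi>. g \<pi> e) = (\<Otimes>e\<in>dom \<pi>. ?ev (g \<pi> e))"
      using ev.hom_finprod[OF gc] by (simp add: comp_def)
    also have "\<dots> = ?p"
      by (rule finprod_cong') (use g[OF \<pi>] in auto)
    \<comment> \<open>A product of indicators is the indicator of the conjunction. For a copy
      without edges it is the empty product one, matching the vacuous condition.\<close>
    also have "?p = (if \<forall>e\<in>dom \<pi>. x e = \<phi> (the (\<pi> e)) then \<one> else \<zero>)"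
    proof (cases "\<forall>e\<in>dom \<pi>. x e = \<phi> (the (\<pi> e))")
      case True
      then have "?p = \<one>" by (intro finprod_one_eqI) simp
      with True show ?thesis by simp
    next
      case False
      then have "?p = \<zero>" by (subst finprod_eq_zero_iff[OF dom]) auto
      with False show ?thesis by (simp only: if_False)
    qed
    finally have "?ev (\<Otimes>\<^bsub>?R\<^esub>e\<in>dom \<pi>. g \<pi> e)
        = (if \<forall>e\<in>dom \<pi>. x e = \<phi> (the (\<pi> e)) then \<one> else \<zero>)" .
    moreover have "(\<Otimes>\<^bsub>?R\<^esub>e\<in>dom \<pi>. g \<pi> e) \<in> carrier ?R"
      using gc by (rule ev.R.finprod_closed)
    ultimately show ?thesis
      by (simp add: f_def a_minus_def r_neg)
  qed
  then have fc: "f \<in> iso_set G H \<rightarrow> carrier ?R" by blast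
  then show "ramsey_poly1 R G H \<phi> \<in> carrier ?R"
    unfolding poly by (rule ev.R.finprod_closed)
  have "?ev (ramsey_poly1 R G H \<phi>) = (\<Otimes>\<pi>\<in>iso_set G H. ?ev (f \<pi>))"
    unfolding poly using ev.hom_finprod[OF fc] by (simp add: comp_def)
  then show "?ev (ramsey_poly1 R G H \<phi>) = \<zero>
      \<longleftrightarrow> (\<exists>\<pi>\<in>iso_set G H. \<forall>e\<in>dom \<pi>. x e = \<phi> (the (\<pi> e)))"
    using f finite_iso_set[OF G H] by (simp add: finprod_eq_zero_iff Pi_def)
qed

text \<open>One more product, now over \<open>J\<close>: a zero comes from some \<open>j\<close>.
  For empty \<open>J\<close> the polynomial is one and has no zeros, as the criterion says.\<close>

lemma ramsey_poly_eval:
  fixes H :: "'j \<Rightarrow> 'w ugraph" and \<phi> :: "'j \<Rightarrow> 'w set \<Rightarrow> 'a"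
  assumes J: "finite J" and H: "\<And>j. j \<in> J \<Longrightarrow> graph (H j)"
    and \<phi>: "\<And>j. j \<in> J \<Longrightarrow> \<phi> j \<in> edges (H j) \<rightarrow> carrier R"
  shows "ramsey_poly R G J H \<phi> \<in> carrier (mpoly_ring R (edges G))"
    and "mpoly_eval R (ramsey_poly R G J H \<phi>) x = \<zero>
      \<longleftrightarrow> (\<exists>j\<in>J. \<exists>\<pi>\<in>iso_set G (H j). \<forall>e\<in>dom \<pi>. x e = \<phi> j (the (\<pi> e)))"
proof -
  have c: "(\<lambda>j. ramsey_poly1 R G (H j) (\<phi> j)) \<in> J \<rightarrow> carrier (mpoly_ring R (edges G))"
    using ramsey_poly1_eval(1)[OF H \<phi>] by blast
  then show "ramsey_poly R G J H \<phi> \<in> carrier (mpoly_ring R (edges G))"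
    unfolding ramsey_poly_def by (rule ev.R.finprod_closed)
  have "mpoly_eval R (ramsey_poly R G J H \<phi>) x
      = (\<Otimes>j\<in>J. mpoly_eval R (ramsey_poly1 R G (H j) (\<phi> j)) x)"
    unfolding ramsey_poly_def using ev.hom_finprod[OF c] by (simp add: comp_def)
  then show "mpoly_eval R (ramsey_poly R G J H \<phi>) x = \<zero>
      \<longleftrightarrow> (\<exists>j\<in>J. \<exists>\<pi>\<in>iso_set G (H j). \<forall>e\<in>dom \<pi>. x e = \<phi> j (the (\<pi> e)))"
    using J c ramsey_poly1_eval(2)[OF H \<phi>]
    by (simp add: finprod_eq_zero_iff Pi_def)
qed

end

end

section \<open>From the generator to the ideal, and the equivalence of the conditions\<close>

text \<open>In a commutative ring the ideal generated by \<open>P\<close> consists of the multiples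
  of \<open>P\<close>, and their values are multiples of the value of \<open>P\<close>.\<close>

lemma (in cring) genideal_vanish_iff:
  assumes x: "x \<in> E \<rightarrow> carrier R" and P: "P \<in> carrier (mpoly_ring R E)"
  shows "(\<forall>Q\<in>Idl\<^bsub>mpoly_ring R E\<^esub> {P}. mpoly_eval R Q x = \<zero>) \<longleftrightarrow> mpoly_eval R P x = \<zero>"
proof -
  interpret ev: ring_hom_cring "mpoly_ring R E" R "\<lambda>P. mpoly_eval R P x"
    by (rule mpoly_eval_hom[OF x])
  have "P \<in> Idl\<^bsub>mpoly_ring R E\<^esub> {P}"
    using P by (rule ev.R.genideal_self')
  moreover have "Idl\<^bsub>mpoly_ring R E\<^esub> {P} = {Q \<otimes>\<^bsub>mpoly_ring R E\<^esub> P | Q. Q \<in> carrier (mpoly_ring R E)}"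
    using ev.R.cgenideal_eq_genideal[OF P] by (simp add: cgenideal_def)
  ultimately show ?thesis
    using P by auto
qed

theorem theorem6:
  fixes G :: "'i::{wellorder,order_bot} \<Rightarrow> 'v ugraph"
    and A :: "'i \<Rightarrow> 'a set"
    and S :: "'i \<Rightarrow> ('v set \<Rightarrow> 'a) set"
    and J :: "'i \<Rightarrow> 'j set"
    and H :: "'i \<Rightarrow> 'j \<Rightarrow> 'w ugraph"
    and \<psi> :: "'i \<Rightarrow> 'j \<Rightarrow> 'w set \<Rightarrow> 'a"
    and K :: "'i \<Rightarrow> 'k ring"
    and q :: "'i \<Rightarrow> nat"
    and f :: "'i \<Rightarrow> 'a \<Rightarrow> 'k"
    and S' :: "'i \<Rightarrow> ('v set \<Rightarrow> 'k) set"
    and C' :: "'i \<Rightarrow> 'j \<Rightarrow> 'w set \<Rightarrow> 'k"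
    and n :: 'i
  assumes "ramsey_base G A S"
    and "ramsey_symbol A J H \<psi>"
    and "locally_finite_type A"
    and "\<And>i. primepow (q i) \<and> card (A i) \<le> q i"
    and "\<And>i. field (K i) \<and> order (K i) = q i"
    and "\<And>i. f i \<in> A i \<rightarrow> carrier (K i) \<and> inj_on (f i) (A i)"
    and "\<And>i. S' i = {compose (edges (G i)) (f i) \<rho> | \<rho>. \<rho> \<in> S i}"
    and "\<And>i j. j \<in> J i \<Longrightarrow> C' i j = compose (edges (H i j)) (f i) (\<psi> i j)"
  shows "let V_cond = (\<lambda>m. \<forall>t\<ge>m.
               S' t \<subseteq> zero_locus (K t) (edges (G t)) (ramsey_ideal (K t) (G t) (J t) (H t) (C' t)));
             I_cond = (\<lambda>m. \<forall>t\<ge>m.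
               vanishing_ideal (K t) (edges (G t)) (S' t) \<supseteq> ramsey_ideal (K t) (G t) (J t) (H t) (C' t))
         in (ramsey_number G S J H \<psi> = Some n \<longleftrightarrow> is_least V_cond n) \<and>
            (ramsey_number G S J H \<psi> = Some n \<longleftrightarrow> is_least I_cond n) \<and>
            (\<forall>m. V_cond m \<longleftrightarrow> I_cond m)"
proof -
  \<comment> \<open>The equivalences hold for each single \<open>t\<close>; the quantifier over
    \<open>t\<close> and the minimality of \<open>n\<close> are then carried along.\<close>
  have *: "(S' t \<subseteq> zero_locus (K t) (edges (G t)) (ramsey_ideal (K t) (G t) (J t) (H t) (C' t)) \<longleftrightarrow>
        (\<forall>\<rho>\<in>S t. \<exists>j\<in>J t. \<exists>\<pi>\<in>iso_set (G t) (H t j). \<forall>e\<in>dom \<pi>. \<rho> e = \<psi> t j (the (\<pi> e)))) \<and>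
      (ramsey_ideal (K t) (G t) (J t) (H t) (C' t) \<subseteq> vanishing_ideal (K t) (edges (G t)) (S' t) \<longleftrightarrow>
        (\<forall>\<rho>\<in>S t. \<exists>j\<in>J t. \<exists>\<pi>\<in>iso_set (G t) (H t j). \<forall>e\<in>dom \<pi>. \<rho> e = \<psi> t j (the (\<pi> e))))"
    for t
  proof -
    interpret K: field "K t" using assms(5) by blast
    let ?E = "edges (G t)"
    let ?p = "ramsey_poly (K t) (G t) (J t) (H t) (C' t)"
    have f: "f t \<in> A t \<rightarrow> carrier (K t)" "inj_on (f t) (A t)" using assms(6) by auto
    \<comment> \<open>A prime power is positive, whereas an infinite carrier would have order
      zero.\<close>
    have fin: "finite (carrier (K t))"
      using assms(4,5)[of t] primepow_gt_0_nat[of "q t"] K.order_gt_0_iff_finite by simp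
    have G: "graph (G t)" and S: "\<And>\<rho>. \<rho> \<in> S t \<Longrightarrow> \<rho> \<in> ?E \<rightarrow>\<^sub>E A t"
      using assms(1) by (auto simp: ramsey_base_def edge_colorings_def)
    have J: "finite (J t)" and H: "\<And>j. j \<in> J t \<Longrightarrow> graph (H t j)"
      and \<psi>: "\<And>j. j \<in> J t \<Longrightarrow> \<psi> t j \<in> edges (H t j) \<rightarrow>\<^sub>E A t"
      using assms(2) by (auto simp: ramsey_symbol_def edge_colorings_def)
    have C: "C' t j \<in> edges (H t j) \<rightarrow> carrier (K t)" if "j \<in> J t" for j
      using f(1) \<psi>[OF that] by (auto simp: assms(8)[OF that] compose_def)
    have pt: "compose ?E (f t) \<rho> \<in> ?E \<rightarrow>\<^sub>E carrier (K t)" if "\<rho> \<in> S t" for \<rho>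
      using f(1) S[OF that] by (auto simp: compose_def)
    then have pt': "compose ?E (f t) \<rho> \<in> ?E \<rightarrow> carrier (K t)" if "\<rho> \<in> S t" for \<rho>
      using that by blast
    \<comment> \<open>Membership was proved relative to a fixed point; the zero colouring serves as
      one.\<close>
    have p: "?p \<in> carrier (mpoly_ring (K t) ?E)"
      using K.ramsey_poly_eval(1)[OF fin G _ J H C, of "\<lambda>_. \<zero>\<^bsub>K t\<^esub>"] by simp
    have eval: "mpoly_eval (K t) ?p (compose ?E (f t) \<rho>) = \<zero>\<^bsub>K t\<^esub> \<longleftrightarrow>
        (\<exists>j\<in>J t. \<exists>\<pi>\<in>iso_set (G t) (H t j). \<forall>e\<in>dom \<pi>. \<rho> e = \<psi> t j (the (\<pi> e)))"
      if \<rho>: "\<rho> \<in> S t" for \<rho>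
    proof -
      \<comment> \<open>On edges of the two graphs \<open>compose\<close> is true composition, and
        there both colours lie in \<open>A t\<close>, where \<open>f t\<close> is injective.\<close>
      have "compose ?E (f t) \<rho> e = C' t j (the (\<pi> e)) \<longleftrightarrow> \<rho> e = \<psi> t j (the (\<pi> e))"
        if j: "j \<in> J t" and \<pi>: "\<pi> \<in> iso_set (G t) (H t j)" and e: "e \<in> dom \<pi>" for j \<pi> e
      proof -
        have "e \<in> ?E" "the (\<pi> e) \<in> edges (H t j)"
          using dom_iso_set[OF \<pi>] ran_iso_set[OF \<pi> e] e by auto
        moreover from this have "\<rho> e \<in> A t" "\<psi> t j (the (\<pi> e)) \<in> A t"
          using S[OF \<rho>] \<psi>[OF j] by auto
        ultimately show ?thesis
          using inj_on_eq_iff[OF f(2)] by (simp add: assms(8)[OF j] compose_def)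
      qed
      then show ?thesis
        using K.ramsey_poly_eval(2)[OF fin G pt'[OF \<rho>] J H C] by simp
    qed
    have vanish: "(\<forall>P\<in>ramsey_ideal (K t) (G t) (J t) (H t) (C' t).
          mpoly_eval (K t) P (compose ?E (f t) \<rho>) = \<zero>\<^bsub>K t\<^esub>) \<longleftrightarrow>
        (\<exists>j\<in>J t. \<exists>\<pi>\<in>iso_set (G t) (H t j). \<forall>e\<in>dom \<pi>. \<rho> e = \<psi> t j (the (\<pi> e)))"
      if \<rho>: "\<rho> \<in> S t" for \<rho>
      unfolding ramsey_ideal_def K.genideal_vanish_iff[OF pt'[OF \<rho>] p] by (rule eval[OF \<rho>])
    interpret P: cring "mpoly_ring (K t) ?E" by (rule K.cring_mpoly_ring)
    \<comment> \<open>\<open>vanishing_ideal\<close> also demands membership in the polynomial ring,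
      which has to be secured before the inclusion reduces to vanishing.\<close>
    have "ramsey_ideal (K t) (G t) (J t) (H t) (C' t) \<subseteq> carrier (mpoly_ring (K t) ?E)"
      unfolding ramsey_ideal_def
      using P.genideal_ideal[of "{?p}"] p
      by (auto dest: ideal.Icarr)
    then have "ramsey_ideal (K t) (G t) (J t) (H t) (C' t) \<subseteq> vanishing_ideal (K t) ?E (S' t) \<longleftrightarrow>
        (\<forall>\<rho>\<in>S t. \<forall>P\<in>ramsey_ideal (K t) (G t) (J t) (H t) (C' t).
          mpoly_eval (K t) P (compose ?E (f t) \<rho>) = \<zero>\<^bsub>K t\<^esub>)"
      unfolding vanishing_ideal_def assms(7) by blast
    moreover have "S' t \<subseteq> zero_locus (K t) ?E (ramsey_ideal (K t) (G t) (J t) (H t) (C' t)) \<longleftrightarrow>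
        (\<forall>\<rho>\<in>S t. \<forall>P\<in>ramsey_ideal (K t) (G t) (J t) (H t) (C' t).
          mpoly_eval (K t) P (compose ?E (f t) \<rho>) = \<zero>\<^bsub>K t\<^esub>)"
      using pt unfolding zero_locus_def assms(7) by (auto simp del: PiE_iff)
    ultimately show ?thesis
      by (simp add: vanish)
  qed
  \<comment> \<open>In a well-order the \<open>LEAST\<close> bound is itself a bound as soon as one
    exists; if none exists, both sides are false.\<close>
  have least: "ramsey_number G S J H \<psi> = Some n \<longleftrightarrow> is_least (ramsey_bound G S J H \<psi>) n"
    unfolding ramsey_number_def is_least_def
    by (auto intro: LeastI Least_le intro!: Least_equality)
  show ?thesis
    using least * by (simp add: ramsey_bound_def[abs_def])
qed

end
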